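(* Assume that $G$ is twice differentiable and strongly convex on $[-\gamma,\gamma]$, with constants $\underline{\sigma}_\gamma,\bar{\sigma}_\gamma>0$ such that $\underline{\sigma}_\gamma^2\le G''(x)\le \bar{\sigma}_\gamma^2$ for all $x\in[-\gamma,\gamma]$. There exist two constants $c>0$ and $\theta>0$ such that, for all $m_1,m_2\ge2$, $1\le r\le \min(m_1,m_2)$ and $\gamma>0$, $$\inf_{\hat X}\ \sup_{\bar X\in\mathcal{F}(r,\gamma)}\ \mathbb{P}_{\bar X}\left(\frac{\|\hat X-\bar X\|_{2}^2}{m_1m_2}>c\,\min\left\{\gamma^2,\ \frac{Mr}{n\,\bar\sigma_\gamma^2}\right\}\right)\ge\theta,$$ where the infimum is over all estimators $\hat X$ that are measurable functions of the data $(\omega_i,Y_i)_{i=1}^n$.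
   Context: $\|\cdot\|_2$ is the Frobenius norm, $\|X\|_\infty=\max_{i,j}|X_{i,j}|$, $M=\max(m_1,m_2)$, $[n]=\{1,\dots,n\}$, and $$\mathcal{F}(r,\gamma)=\{X\in\mathbb{R}^{m_1\times m_2}:\ \mathrm{rank}(X)\le r,\ \|X\|_\infty\le\gamma\}.$$ Model: for a parameter matrix $\bar X\in\mathbb{R}^{m_1\times m_2}$, $\mathbb{P}_{\bar X}$ is the law of the data $(\omega_i,Y_i)_{i=1}^n$ where the indexes $(\omega_i)_{i=1}^n\in([m_1]\times[m_2])^n$ are i.i.d. with some distribution $\Pi$ and, conditionally on the indexes, the real observations $Y_i$ are independent, $Y_i$ following the natural exponential family distribution with density $h(y)\exp(\bar X_{\omega_i}y-G(\bar X_{\omega_i}))$, where $h$ is the base measure function and $G$ the log-partition function (convex). The constants $c$ and $\theta$ are universal (independent of $m_1,m_2,r,\gamma,n$ and $\bar\sigma_\gamma$). *)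

theory Defs
  imports "HOL-Probability.Probability" "Jordan_Normal_Form.DL_Rank"
begin

definition mat_frob_norm :: "real mat \<Rightarrow> real" where
  "mat_frob_norm X = sqrt (\<Sum>i<dim_row X. \<Sum>j<dim_col X. (X $$ (i, j))\<^sup>2)"

definition mat_max_norm :: "real mat \<Rightarrow> real" where
  "mat_max_norm X = Max {\<bar>X $$ (i, j)\<bar> | i j. i < dim_row X \<and> j < dim_col X}"

(* The column space lives in dimension m1, which is the first parameter of vec_space.rank. *)
definition low_rank_class :: "nat \<Rightarrow> nat \<Rightarrow> nat \<Rightarrow> real \<Rightarrow> real mat set" where
  "low_rank_class m1 m2 r \<gamma> =
     {X \<in> carrier_mat m1 m2. vec_space.rank m1 X \<le> r \<and> mat_max_norm X \<le> \<gamma>}"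

definition exp_family_dist :: "real measure \<Rightarrow> (real \<Rightarrow> real) \<Rightarrow> (real \<Rightarrow> real) \<Rightarrow> real \<Rightarrow> real measure"
  where "exp_family_dist \<nu> h G x = density \<nu> (\<lambda>y. ennreal (h y * exp (x * y - G x)))"

(* The densities are taken with respect to a sigma-finite reference measure \<nu> on the line, e.g.
   Lebesgue measure or counting measure on the integers. The last clause says that G is the
   log-partition function ln (\<integral> h(y) exp(x y) d\<nu>(y)) at every natural parameter x in S,
   in particular that this integral is finite and positive there. *)
definition natural_exp_family ::
    "real measure \<Rightarrow> (real \<Rightarrow> real) \<Rightarrow> (real \<Rightarrow> real) \<Rightarrow> real set \<Rightarrow> bool" where
  "natural_exp_family \<nu> h G S \<longleftrightarrow>
     sigma_finite_measure \<nu> \<and> sets \<nu> = sets borel \<and>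
     h \<in> borel_measurable borel \<and> (\<forall>y. 0 \<le> h y) \<and>
     (\<forall>x\<in>S. (\<integral>\<^sup>+ y. ennreal (h y * exp (x * y)) \<partial>\<nu>) = ennreal (exp (G x)))"

(* Derivatives are relative to S, hence one-sided at the end points of a closed interval. They
   are uniquely determined when S is a nondegenerate interval. *)
definition second_deriv_bounds :: "(real \<Rightarrow> real) \<Rightarrow> real set \<Rightarrow> real \<Rightarrow> real \<Rightarrow> bool" where
  "second_deriv_bounds G S \<sigma>lo \<sigma>hi \<longleftrightarrow>
     (\<exists>G' G''. \<forall>x\<in>S. (G has_real_derivative G' x) (at x within S) \<and>
        (G' has_real_derivative G'' x) (at x within S) \<and>
        \<sigma>lo\<^sup>2 \<le> G'' x \<and> G'' x \<le> \<sigma>hi\<^sup>2)"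

(* Matrix positions and observation numbers are counted from 0. *)
definition data_space :: "nat \<Rightarrow> nat \<Rightarrow> nat \<Rightarrow> (nat \<Rightarrow> (nat \<times> nat) \<times> real) measure" where
  "data_space m1 m2 n = (\<Pi>\<^sub>M i\<in>{..<n}. count_space ({..<m1} \<times> {..<m2}) \<Otimes>\<^sub>M borel)"

definition data_law :: "nat \<Rightarrow> nat \<Rightarrow> nat \<Rightarrow> (nat \<times> nat) measure \<Rightarrow> real measure \<Rightarrow>
    (real \<Rightarrow> real) \<Rightarrow> (real \<Rightarrow> real) \<Rightarrow> real mat \<Rightarrow> (nat \<Rightarrow> (nat \<times> nat) \<times> real) measure" where
  "data_law m1 m2 n \<pi> \<nu> h G X =
     do {
       \<omega> \<leftarrow> (\<Pi>\<^sub>M i\<in>{..<n}. \<pi>);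
       Y \<leftarrow> (\<Pi>\<^sub>M i\<in>{..<n}. exp_family_dist \<nu> h G (X $$ \<omega> i));
       return (data_space m1 m2 n) (\<lambda>i\<in>{..<n}. (\<omega> i, Y i))
     }"

(* Measurability into the space of m1 x m2 matrices is measurability of every entry. *)
definition estimators :: "nat \<Rightarrow> nat \<Rightarrow> nat \<Rightarrow> ((nat \<Rightarrow> (nat \<times> nat) \<times> real) \<Rightarrow> real mat) set" where
  "estimators m1 m2 n =
     {T. (\<forall>d\<in>space (data_space m1 m2 n). T d \<in> carrier_mat m1 m2) \<and>
         (\<forall>i<m1. \<forall>j<m2. (\<lambda>d. T d $$ (i, j)) \<in> borel_measurable (data_space m1 m2 n))}"

end

theory Submission
  imports Defs
begin

text \<open>
  The bound is proved by an Assouad argument. Let \<open>M = max m1 m2\<close>. Label every matrix position by one of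
  \<open>M r\<close> labels in such a way that each label is shared by at most \<open>2 m1 m2 / (M r)\<close> positions and every matrix that
  depends on the position only through its label has rank at most \<open>r\<close>: if \<open>m1 \<ge> m2\<close>, a label consists of
  the row and the column modulo \<open>r\<close>, otherwise of the column and the row modulo \<open>r\<close>. For a set \<open>P\<close> of
  labels let \<open>X P\<close> have the entry \<open>\<kappa>\<close> at positions with label in \<open>P\<close> and \<open>-\<kappa>\<close> elsewhere. An estimator
  determines a guess of the sign of each entry, and each wrong sign costs at least \<open>\<kappa>\<^sup>2\<close> in the squared
  Frobenius norm (\<open>frob_norm_ge_sign_errors\<close>). So it suffices that, for some \<open>P\<close>, a fixed fraction of all
  signs is wrong with probability bounded below. The expected fraction averaged over all \<open>P\<close> is a sum of
  errors of tests between \<open>X P\<close> and \<open>X (insert a P)\<close>, and as a fraction never exceeds \<open>1\<close>, a lower bound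
  on its mean is also a lower bound in probability (\<open>assouad_in_probability\<close>).

  The testing errors are controlled by the Bhattacharyya affinity, the integral of \<open>sqrt (p q)\<close>, which is
  explicit here: for natural parameters \<open>x\<close> and \<open>y\<close> it is \<open>exp (G ((x + y) / 2) - (G x + G y) / 2)\<close>.
  For \<open>x = \<kappa>\<close> and \<open>y = -\<kappa>\<close> it is at least \<open>1 - \<sigma>hi\<^sup>2 \<kappa>\<^sup>2 / 2\<close>, because \<open>G\<close> minus \<open>\<sigma>hi\<^sup>2 x\<^sup>2 / 2\<close> is
  concave. Hence \<open>n\<close> observations have an affinity of at least \<open>1 - n \<pi>(B a) \<sigma>hi\<^sup>2 \<kappa>\<^sup>2 / 2\<close>, where \<open>B a\<close> is
  the set of positions with label \<open>a\<close>. The sampling law \<open>\<pi>\<close> is arbitrary, so the entries with a single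
  label \<open>a\<close> may be easy to estimate, but the bound is linear in \<open>\<pi>(B a)\<close> and these numbers sum to \<open>1\<close>
  over all labels. With \<open>\<kappa>\<^sup>2 = min (\<gamma>\<^sup>2) (M r / (n \<sigma>hi\<^sup>2)) / 4\<close> the mean fraction of wrong signs is at
  least \<open>1/8\<close>, so that it exceeds \<open>1/16\<close> with probability at least \<open>1/16\<close>. This gives \<open>\<theta> = 1/16\<close> and
  \<open>c = 1/64\<close>, which is \<open>1/4\<close> from the definition of \<open>\<kappa>\<close> times \<open>1/16\<close>.
\<close>

section \<open>Averaging over sign patterns\<close>

text \<open>
  A reverse Markov inequality: the number of events that occur is at most \<open>card W\<close> always, and at most
  \<open>\<eta> card W\<close> off the event that many of them occur. Read backwards, a large sum of probabilities forces
  many of the events to occur together with a definite probability.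
\<close>

lemma (in prob_space) sum_prob_le_prob_many:
  fixes \<eta> :: real
  assumes "finite W" and E: "\<And>w. w \<in> W \<Longrightarrow> E w \<in> events" and "0 \<le> \<eta>"
  shows "(\<Sum>w\<in>W. prob (E w)) \<le>
    real (card W) * prob {x \<in> space M. \<eta> * real (card W) < real (card {w\<in>W. x \<in> E w})}
      + \<eta> * real (card W)"
proof -
  let ?F = "{x \<in> space M. \<eta> * real (card W) < real (card {w\<in>W. x \<in> E w})}"
  have card_eq: "real (card {w\<in>W. x \<in> E w}) = (\<Sum>w\<in>W. indicator (E w) x)" for x
    using assms(1) by (simp add: indicator_def sum.If_cases Int_def)
  have [measurable]: "(\<lambda>x. \<Sum>w\<in>W. indicator (E w) x :: real) \<in> borel_measurable M"
    using E by (intro borel_measurable_sum borel_measurable_indicator)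
  have F[measurable]: "?F \<in> events"
    unfolding card_eq by measurable
  have "(\<Sum>w\<in>W. prob (E w)) = expectation (\<lambda>x. \<Sum>w\<in>W. indicator (E w) x)"
    using E by (subst Bochner_Integration.integral_sum) (auto simp: integrable_indicator_iff emeasure_eq_measure)
  also have "\<dots> \<le> expectation (\<lambda>x. real (card W) * indicator ?F x + \<eta> * real (card W))"
  proof (rule integral_mono)
    show "integrable M (\<lambda>x. \<Sum>w\<in>W. indicator (E w) x :: real)"
      using E by (intro Bochner_Integration.integrable_sum) (auto simp: integrable_indicator_iff emeasure_eq_measure)
    show "integrable M (\<lambda>x. real (card W) * indicator ?F x + \<eta> * real (card W))"
      by (intro Bochner_Integration.integrable_add integrable_mult_right integrable_const)
        (auto simp: integrable_indicator_iff emeasure_eq_measure)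
    fix x assume "x \<in> space M"
    have "real (card {w\<in>W. x \<in> E w}) \<le> real (card W)"
      using assms(1) by (intro of_nat_mono card_mono) auto
    then have "real (card {w\<in>W. x \<in> E w}) \<le> real (card W) * indicator ?F x + \<eta> * real (card W)"
      using \<open>x \<in> space M\<close> assms(3) by (auto simp: indicator_def not_less intro: add_increasing2)
    then show "(\<Sum>w\<in>W. indicator (E w) x) \<le> real (card W) * indicator ?F x + \<eta> * real (card W)"
      by (simp add: card_eq)
  qed
  also have "\<dots> = real (card W) * prob ?F + \<eta> * real (card W)"
    by (subst Bochner_Integration.integral_add)
      (auto simp: integrable_indicator_iff emeasure_eq_measure prob_space)
  finally show ?thesis .
qed

lemma sum_Pow_split:
  fixes f :: "'a set \<Rightarrow> real"
  assumes "finite A" "a \<in> A"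
  shows "(\<Sum>S\<in>Pow A. f S) = (\<Sum>S\<in>Pow (A - {a}). f S + f (insert a S))"
proof -
  have A: "A = insert a (A - {a})" using assms by auto
  have "(\<Sum>S\<in>Pow A. f S) = (\<Sum>S\<in>Pow (A - {a}) \<union> insert a ` Pow (A - {a}). f S)"
    by (subst A, subst Pow_insert) simp
  also have "\<dots> = (\<Sum>S\<in>Pow (A - {a}). f S) + (\<Sum>S\<in>insert a ` Pow (A - {a}). f S)"
    using assms by (intro sum.union_disjoint) auto
  also have "(\<Sum>S\<in>insert a ` Pow (A - {a}). f S) = (\<Sum>S\<in>Pow (A - {a}). f (insert a S))"
    by (rule sum.reindex_cong[of "insert a"]) (auto intro!: inj_onI)
  finally show ?thesis by (simp add: sum.distrib)
qed

text \<open>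
  Under the uniform prior on the subsets of \<open>A\<close>, the error made at \<open>w\<close> is the average, over the pairs of
  subsets that differ in \<open>lab w\<close> only, of the error of the test \<open>\<phi> w\<close> between the two laws of the pair.
  The weights \<open>t a\<close> may differ from label to label: only their sum over the positions matters.
\<close>

lemma assouad_in_probability:
  fixes P :: "'l set \<Rightarrow> 'a measure" and t :: "'l \<Rightarrow> real" and \<eta> :: real
  assumes fin: "finite A" "finite W" and lab: "\<And>w. w \<in> W \<Longrightarrow> lab w \<in> A"
    and P: "\<And>S. S \<subseteq> A \<Longrightarrow> prob_space (P S)" "\<And>S. S \<subseteq> A \<Longrightarrow> sets (P S) = sets N"
    and \<phi>: "\<And>w. w \<in> W \<Longrightarrow> \<phi> w \<in> sets N" and "0 \<le> \<eta>"
    and test: "\<And>a S E. a \<in> A \<Longrightarrow> S \<subseteq> A - {a} \<Longrightarrow> E \<in> sets N \<Longrightarrow>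
      t a \<le> measure (P S) E + measure (P (insert a S)) (space N - E)"
  shows "\<exists>S\<subseteq>A. (\<Sum>w\<in>W. t (lab w)) / 2 \<le> real (card W) * measure (P S)
      {d \<in> space N. \<eta> * real (card W) < real (card {w\<in>W. (d \<in> \<phi> w) \<noteq> (lab w \<in> S)})}
        + \<eta> * real (card W)"
proof -
  define wrong where "wrong S w = (if lab w \<in> S then space N - \<phi> w else \<phi> w)" for S w
  define q where "q S = measure (P S)
      {d \<in> space N. \<eta> * real (card W) < real (card {w\<in>W. (d \<in> \<phi> w) \<noteq> (lab w \<in> S)})}" for S
  have half: "real (card (Pow (A - {lab w}))) = 2 ^ card A / 2" if "w \<in> W" for w
  proof -
    have "card A = Suc (card (A - {lab w}))"
      using fin lab[OF that] by (metis card_Suc_Diff1)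
    then show ?thesis using fin by (simp add: card_Pow)
  qed
  have "2 ^ card A * ((\<Sum>w\<in>W. t (lab w)) / 2) = (\<Sum>w\<in>W. 2 ^ card A / 2 * t (lab w))"
    by (simp add: sum_distrib_left sum_divide_distrib)
  also have "\<dots> \<le> (\<Sum>w\<in>W. \<Sum>S\<in>Pow A. measure (P S) (wrong S w))"
  proof (rule sum_mono)
    fix w assume w: "w \<in> W"
    \<comment> \<open>Pair each subset without the label of \<open>w\<close> with the same subset after inserting it.\<close>
    have "2 ^ card A / 2 * t (lab w) = (\<Sum>S\<in>Pow (A - {lab w}). t (lab w))"
      using half[OF w] by simp
    also have "\<dots> \<le> (\<Sum>S\<in>Pow (A - {lab w}). measure (P S) (wrong S w)
        + measure (P (insert (lab w) S)) (wrong (insert (lab w) S) w))"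
      using test[OF lab[OF w] _ \<phi>[OF w]] by (intro sum_mono) (auto simp: wrong_def)
    also have "\<dots> = (\<Sum>S\<in>Pow A. measure (P S) (wrong S w))"
      using fin lab[OF w] by (simp add: sum_Pow_split)
    finally show "2 ^ card A / 2 * t (lab w) \<le> (\<Sum>S\<in>Pow A. measure (P S) (wrong S w))" .
  qed
  also have "\<dots> = (\<Sum>S\<in>Pow A. \<Sum>w\<in>W. measure (P S) (wrong S w))"
    by (rule sum.swap)
  also have "\<dots> \<le> (\<Sum>S\<in>Pow A. real (card W) * q S + \<eta> * real (card W))"
  proof (rule sum_mono)
    fix S assume "S \<in> Pow A"
    then have S: "S \<subseteq> A" by simp
    interpret prob_space "P S" using P(1)[OF S] .
    have sp: "space (P S) = space N" using P(2)[OF S] by (rule sets_eq_imp_space_eq)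
    have "{w\<in>W. d \<in> wrong S w} = {w\<in>W. (d \<in> \<phi> w) \<noteq> (lab w \<in> S)}" if "d \<in> space N" for d
      using that by (auto simp: wrong_def)
    then have eq: "{d \<in> space N. \<eta> * real (card W) < real (card {w\<in>W. d \<in> wrong S w})} =
        {d \<in> space N. \<eta> * real (card W) < real (card {w\<in>W. (d \<in> \<phi> w) \<noteq> (lab w \<in> S)})}"
      by auto
    have "wrong S w \<in> events" if "w \<in> W" for w
      using \<phi>[OF that] P(2)[OF S] by (auto simp: wrong_def)
    with sum_prob_le_prob_many[OF fin(2) _ \<open>0 \<le> \<eta>\<close>, of "wrong S"]
    show "(\<Sum>w\<in>W. measure (P S) (wrong S w)) \<le> real (card W) * q S + \<eta> * real (card W)"
      by (simp only: sp eq q_def)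
  qed
  finally have avg: "2 ^ card A * ((\<Sum>w\<in>W. t (lab w)) / 2) \<le>
      (\<Sum>S\<in>Pow A. real (card W) * q S + \<eta> * real (card W))" .
  have "\<exists>S\<in>Pow A. (\<Sum>w\<in>W. t (lab w)) / 2 \<le> real (card W) * q S + \<eta> * real (card W)"
  proof (rule ccontr)
    assume "\<not> ?thesis"
    then have "(\<Sum>S\<in>Pow A. real (card W) * q S + \<eta> * real (card W)) <
        (\<Sum>S\<in>Pow A. (\<Sum>w\<in>W. t (lab w)) / 2)"
      using fin by (intro sum_strict_mono) (auto simp: not_le)
    with avg fin show False by (simp add: card_Pow)
  qed
  then show ?thesis by (auto simp: q_def)
qed

section \<open>Testing two hypotheses\<close>

text \<open>
  The AM-GM inequality with unequal weights. The small coefficient \<open>1/8\<close> makes the total mass \<open>2\<close> of the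
  two densities count for \<open>1/4\<close> only, well below an affinity close to \<open>1\<close>.
\<close>

lemma sqrt_mult_le_testing:
  fixes p q :: real
  assumes "0 \<le> p" "0 \<le> q"
  shows "sqrt (p * q) \<le> 2 * p + q / 8" "sqrt (p * q) \<le> 2 * q + p / 8"
proof -
  have *: "sqrt (x * y) \<le> 2 * x + y / 8" if "0 \<le> x" "0 \<le> y" for x y :: real
  proof -
    have "sqrt (x * y) = sqrt ((4 * x) * (y / 4))" by simp
    also have "\<dots> \<le> (4 * x + y / 4) / 2"
      using that by (intro arith_geo_mean_sqrt) auto
    finally show ?thesis by simp
  qed
  show "sqrt (p * q) \<le> 2 * p + q / 8" "sqrt (p * q) \<le> 2 * q + p / 8"
    using *[of p q] *[of q p] assms by (simp_all add: mult.commute)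
qed

text \<open>
  Integrate \<open>sqrt_mult_le_testing\<close>, with the factor \<open>2\<close> put on \<open>p\<close> where the test rejects \<open>p\<close> and on \<open>q\<close>
  elsewhere. A bound that is linear in the affinity, unlike the usual quadratic one, can be summed over
  many pairs of hypotheses.
\<close>

lemma testing_error_ge_affinity:
  fixes p q :: "'a \<Rightarrow> real" and \<rho> :: real
  assumes [measurable]: "p \<in> borel_measurable R" "q \<in> borel_measurable R" "E \<in> sets R"
    and nn: "\<And>x. 0 \<le> p x" "\<And>x. 0 \<le> q x"
    and P: "prob_space (density R p)" and Q: "prob_space (density R q)"
    and \<rho>: "ennreal \<rho> \<le> (\<integral>\<^sup>+x. ennreal (sqrt (p x * q x)) \<partial>R)"
  shows "(\<rho> - 1 / 4) / 2 \<le> measure (density R p) E + measure (density R q) (space R - E)"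
proof -
  interpret P: prob_space "density R p" by fact
  interpret Q: prob_space "density R q" by fact
  have one: "(\<integral>\<^sup>+x. p x \<partial>R) = 1" "(\<integral>\<^sup>+x. q x \<partial>R) = 1"
    using P.emeasure_space_1 Q.emeasure_space_1 by (auto simp: emeasure_density cong: nn_integral_cong)
  have "ennreal \<rho> \<le> (\<integral>\<^sup>+x. ennreal (sqrt (p x * q x)) \<partial>R)" by (rule \<rho>)
  also have "\<dots> \<le> (\<integral>\<^sup>+x. 2 * (ennreal (p x) * indicator E x) + 2 * (ennreal (q x) * indicator (space R - E) x) +
      (ennreal (1 / 8) * ennreal (p x) + ennreal (1 / 8) * ennreal (q x)) \<partial>R)"
  proof (rule nn_integral_mono)
    fix x assume "x \<in> space R"
    show "ennreal (sqrt (p x * q x)) \<le> 2 * (ennreal (p x) * indicator E x) +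
        2 * (ennreal (q x) * indicator (space R - E) x) +
        (ennreal (1 / 8) * ennreal (p x) + ennreal (1 / 8) * ennreal (q x))"
    proof (cases "x \<in> E")
      case True
      have "ennreal (sqrt (p x * q x)) \<le> ennreal (2 * p x + (1 / 8 * p x + 1 / 8 * q x))"
        using sqrt_mult_le_testing(1)[of "p x" "q x"] nn[of x] by (intro ennreal_leI) simp
      also have "\<dots> = ennreal 2 * ennreal (p x) + (ennreal (1 / 8) * ennreal (p x) + ennreal (1 / 8) * ennreal (q x))"
        using nn[of x] by (simp only: ennreal_plus ennreal_mult zero_le_numeral zero_le_divide_1_iff
            mult_nonneg_nonneg add_nonneg_nonneg)
      finally show ?thesis using True by simp
    next
      case False
      have "ennreal (sqrt (p x * q x)) \<le> ennreal (2 * q x + (1 / 8 * p x + 1 / 8 * q x))"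
        using sqrt_mult_le_testing(2)[of "p x" "q x"] nn[of x] by (intro ennreal_leI) simp
      also have "\<dots> = ennreal 2 * ennreal (q x) + (ennreal (1 / 8) * ennreal (p x) + ennreal (1 / 8) * ennreal (q x))"
        using nn[of x] by (simp only: ennreal_plus ennreal_mult zero_le_numeral zero_le_divide_1_iff
            mult_nonneg_nonneg add_nonneg_nonneg)
      finally show ?thesis using False \<open>x \<in> space R\<close> by simp
    qed
  qed
  also have "\<dots> = 2 * emeasure (density R p) E + 2 * emeasure (density R q) (space R - E) +
      (ennreal (1 / 8) * 1 + ennreal (1 / 8) * 1)"
    by (simp add: nn_integral_add nn_integral_cmult emeasure_density one)
  also have "\<dots> = ennreal (2 * measure (density R p) E + 2 * measure (density R q) (space R - E) + 1 / 4)"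
  proof -
    have "2 * a + 2 * b + 1 / 4 = 2 * a + 2 * b + (1 / 8 + 1 / 8)" for a b :: real by simp
    then show ?thesis
      by (simp only: P.emeasure_eq_measure Q.emeasure_eq_measure ennreal_plus ennreal_mult measure_nonneg
          ennreal_numeral zero_le_numeral zero_le_divide_1_iff mult_nonneg_nonneg add_nonneg_nonneg mult_1_right)
  qed
  finally show ?thesis
    by (subst (asm) ennreal_le_iff) auto
qed

section \<open>Low-rank sign matrices\<close>

lemma rank_sum_product_entries:
  fixes u v :: "nat \<Rightarrow> nat \<Rightarrow> real"
  shows "vec_space.rank m1 (mat m1 m2 (\<lambda>(i, j). \<Sum>b<r. u b i * v b j)) \<le> r"
proof (induction r)
  case 0
  have "mat m1 m2 (\<lambda>(i, j). \<Sum>b<0. u b i * v b j) = 0\<^sub>m m1 m2" by auto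
  then show ?case by (simp only: vec_space.rank_0I)
next
  case (Suc r)
  let ?A = "mat m1 m2 (\<lambda>(i, j). \<Sum>b<r. u b i * v b j)"
  let ?B = "mat m1 m2 (\<lambda>(i, j). u r i * v r j)"
  have "mat m1 m2 (\<lambda>(i, j). \<Sum>b<Suc r. u b i * v b j) = ?A + ?B"
    by (intro eq_matI) auto
  moreover have "vec_space.rank m1 (?A + ?B) \<le> vec_space.rank m1 ?A + vec_space.rank m1 ?B"
    by (rule vec_space.rank_subadditive) auto
  moreover have "vec_space.rank m1 ?B \<le> 1"
    by (rule vec_space.rank_le_1_product_entries[where f = "u r" and g = "v r"]) auto
  ultimately show ?case using Suc by simp
qed

lemma rank_le_mod_columns:
  fixes F :: "nat \<Rightarrow> nat \<Rightarrow> real"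
  assumes "0 < r"
  shows "vec_space.rank m1 (mat m1 m2 (\<lambda>(i, j). F i (j mod r))) \<le> r"
proof -
  have "mat m1 m2 (\<lambda>(i, j). F i (j mod r)) = mat m1 m2 (\<lambda>(i, j). \<Sum>b<r. F i b * of_bool (j mod r = b))"
    using assms by (intro eq_matI) auto
  then show ?thesis
    by (simp only: rank_sum_product_entries[of m1 m2 "\<lambda>b i. F i b" "\<lambda>b j. of_bool (j mod r = b)"])
qed

lemma rank_le_mod_rows:
  fixes F :: "nat \<Rightarrow> nat \<Rightarrow> real"
  assumes "0 < r"
  shows "vec_space.rank m1 (mat m1 m2 (\<lambda>(i, j). F (i mod r) j)) \<le> r"
proof -
  have "mat m1 m2 (\<lambda>(i, j). F (i mod r) j) = mat m1 m2 (\<lambda>(i, j). \<Sum>b<r. of_bool (i mod r = b) * F b j)"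
    using assms by (intro eq_matI) auto
  then show ?thesis
    by (simp only: rank_sum_product_entries[of m1 m2 "\<lambda>b i. of_bool (i mod r = b)" "\<lambda>b j. F b j"])
qed

text \<open>
  A residue class has at most \<open>(m - 1) div r + 1\<close> members below \<open>m\<close>; rounding costs at most a factor \<open>2\<close>
  because \<open>r \<le> m\<close>.
\<close>

lemma card_residue_class_le:
  fixes r m b :: nat
  assumes "1 \<le> r" "r \<le> m"
  shows "card {j. j < m \<and> j mod r = b} * r \<le> 2 * m"
proof -
  have "card {j. j < m \<and> j mod r = b} \<le> card {..(m - 1) div r}"
  proof (rule card_inj_on_le[where f = "\<lambda>j. j div r"])
    show "inj_on (\<lambda>j. j div r) {j. j < m \<and> j mod r = b}"
      by (intro inj_onI) (metis (mono_tags, lifting) mem_Collect_eq div_mult_mod_eq)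
    show "(\<lambda>j. j div r) ` {j. j < m \<and> j mod r = b} \<subseteq> {..(m - 1) div r}"
      by (auto intro!: div_le_mono)
  qed simp
  then have "card {j. j < m \<and> j mod r = b} * r \<le> ((m - 1) div r + 1) * r"
    by (intro mult_right_mono) auto
  also have "\<dots> = (m - 1) div r * r + r" by simp
  also have "\<dots> \<le> (m - 1) + r" by (intro add_right_mono div_times_less_eq_dividend)
  also have "\<dots> \<le> 2 * m" using assms by simp
  finally show ?thesis .
qed

text \<open>
  The entries with the same label are tied together. A matrix whose columns (or rows) repeat with period
  \<open>r\<close> has rank at most \<open>r\<close>, and repeating along the shorter side leaves \<open>M r\<close> free entries, where \<open>M\<close> is
  the longer side.
\<close>

lemma low_rank_labelling:
  fixes m1 m2 r :: nat
  assumes "1 \<le> r" "r \<le> min m1 m2"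
  obtains lab :: "nat \<times> nat \<Rightarrow> nat \<times> nat"
  where "\<And>a. card {w \<in> {..<m1} \<times> {..<m2}. lab w = a} * (max m1 m2 * r) \<le> 2 * (m1 * m2)"
    and "\<And>S (x::real) y. vec_space.rank m1 (mat m1 m2 (\<lambda>w. if lab w \<in> S then x else y)) \<le> r"
proof (cases "m2 \<le> m1")
  case True
  show ?thesis
  proof (rule that[of "\<lambda>(i, j). (i, j mod r)"])
    fix a :: "nat \<times> nat"
    have "card {w \<in> {..<m1} \<times> {..<m2}. (case w of (i, j) \<Rightarrow> (i, j mod r)) = a} \<le>
        card ({fst a} \<times> {j. j < m2 \<and> j mod r = snd a})"
      by (intro card_mono) auto
    then have "card {w \<in> {..<m1} \<times> {..<m2}. (case w of (i, j) \<Rightarrow> (i, j mod r)) = a} * r \<le> 2 * m2"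
      using card_residue_class_le[of r m2 "snd a"] assms
      by (auto simp: card_cartesian_product intro: order_trans[OF mult_right_mono])
    from mult_left_mono[OF this, of m1]
    show "card {w \<in> {..<m1} \<times> {..<m2}. (case w of (i, j) \<Rightarrow> (i, j mod r)) = a} * (max m1 m2 * r) \<le>
        2 * (m1 * m2)"
      using True by (simp add: ac_simps max_def)
  next
    fix S :: "(nat \<times> nat) set" and x y :: real
    show "vec_space.rank m1 (mat m1 m2 (\<lambda>w. if (case w of (i, j) \<Rightarrow> (i, j mod r)) \<in> S then x else y)) \<le> r"
      using rank_le_mod_columns[of r m1 m2 "\<lambda>i b. if (i, b) \<in> S then x else y"] assms
      by (simp add: case_prod_unfold)
  qed
next
  case False
  show ?thesis
  proof (rule that[of "\<lambda>(i, j). (i mod r, j)"])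
    fix a :: "nat \<times> nat"
    have "card {w \<in> {..<m1} \<times> {..<m2}. (case w of (i, j) \<Rightarrow> (i mod r, j)) = a} \<le>
        card ({i. i < m1 \<and> i mod r = fst a} \<times> {snd a})"
      by (intro card_mono) auto
    then have "card {w \<in> {..<m1} \<times> {..<m2}. (case w of (i, j) \<Rightarrow> (i mod r, j)) = a} * r \<le> 2 * m1"
      using card_residue_class_le[of r m1 "fst a"] assms
      by (auto simp: card_cartesian_product intro: order_trans[OF mult_right_mono])
    from mult_left_mono[OF this, of m2]
    show "card {w \<in> {..<m1} \<times> {..<m2}. (case w of (i, j) \<Rightarrow> (i mod r, j)) = a} * (max m1 m2 * r) \<le>
        2 * (m1 * m2)"
      using False by (simp add: ac_simps max_def)
  next
    fix S :: "(nat \<times> nat) set" and x y :: real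
    show "vec_space.rank m1 (mat m1 m2 (\<lambda>w. if (case w of (i, j) \<Rightarrow> (i mod r, j)) \<in> S then x else y)) \<le> r"
      using rank_le_mod_rows[of r m1 m2 "\<lambda>b j. if (b, j) \<in> S then x else y"] assms
      by (simp add: case_prod_unfold)
  qed
qed

lemma mat_max_norm_le_iff:
  assumes "X \<in> carrier_mat m1 m2" "0 < m1" "0 < m2"
  shows "mat_max_norm X \<le> c \<longleftrightarrow> (\<forall>w \<in> {..<m1} \<times> {..<m2}. \<bar>X $$ w\<bar> \<le> c)"
proof -
  have eq: "{\<bar>X $$ (i, j)\<bar> | i j. i < dim_row X \<and> j < dim_col X} = (\<lambda>w. \<bar>X $$ w\<bar>) ` ({..<m1} \<times> {..<m2})"
    using assms(1) by (auto simp: image_iff Bex_def)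
  show ?thesis
    unfolding mat_max_norm_def eq using assms(2,3) by (subst Max_le_iff) auto
qed

lemma frob_norm_diff_sq:
  assumes "T \<in> carrier_mat m1 m2" "X \<in> carrier_mat m1 m2"
  shows "(mat_frob_norm (T - X))\<^sup>2 = (\<Sum>w\<in>{..<m1} \<times> {..<m2}. (T $$ w - X $$ w)\<^sup>2)"
proof -
  have "(mat_frob_norm (T - X))\<^sup>2 = (\<Sum>i<m1. \<Sum>j<m2. ((T - X) $$ (i, j))\<^sup>2)"
    using assms unfolding mat_frob_norm_def by (simp add: sum_nonneg)
  also have "\<dots> = (\<Sum>i<m1. \<Sum>j<m2. (T $$ (i, j) - X $$ (i, j))\<^sup>2)"
    using assms by (intro sum.cong) auto
  finally show ?thesis by (simp add: sum.cartesian_product case_prod_unfold)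
qed

text \<open>
  A wrong sign at \<open>w\<close> puts \<open>T $$ w\<close> and \<open>X $$ w\<close> on different sides of \<open>0\<close>, hence at distance at least
  \<open>\<kappa>\<close>. The value \<open>0\<close> of the estimator counts as negative.
\<close>

lemma frob_norm_ge_sign_errors:
  fixes \<kappa> :: real
  assumes T: "T \<in> carrier_mat m1 m2" and "0 \<le> \<kappa>"
    and X: "X = mat m1 m2 (\<lambda>w. if lab w \<in> S then \<kappa> else - \<kappa>)"
  shows "\<kappa>\<^sup>2 * real (card {w \<in> {..<m1} \<times> {..<m2}. (0 < T $$ w) \<noteq> (lab w \<in> S)}) \<le>
    (mat_frob_norm (T - X))\<^sup>2"
proof -
  let ?W = "{..<m1} \<times> {..<m2}"
  have "\<kappa>\<^sup>2 * real (card {w \<in> ?W. (0 < T $$ w) \<noteq> (lab w \<in> S)}) =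
      (\<Sum>w\<in>{w \<in> ?W. (0 < T $$ w) \<noteq> (lab w \<in> S)}. \<kappa>\<^sup>2)" by simp
  also have "\<dots> \<le> (\<Sum>w\<in>{w \<in> ?W. (0 < T $$ w) \<noteq> (lab w \<in> S)}. (T $$ w - X $$ w)\<^sup>2)"
  proof (rule sum_mono)
    fix w assume w: "w \<in> {w \<in> ?W. (0 < T $$ w) \<noteq> (lab w \<in> S)}"
    then have "X $$ w = (if lab w \<in> S then \<kappa> else - \<kappa>)" by (auto simp: X)
    with w \<open>0 \<le> \<kappa>\<close> have "\<bar>\<kappa>\<bar> \<le> \<bar>T $$ w - X $$ w\<bar>" by (auto split: if_splits)
    then show "\<kappa>\<^sup>2 \<le> (T $$ w - X $$ w)\<^sup>2" by (simp add: abs_le_square_iff)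
  qed
  also have "\<dots> \<le> (\<Sum>w\<in>?W. (T $$ w - X $$ w)\<^sup>2)"
    by (intro sum_mono2) auto
  also have "\<dots> = (mat_frob_norm (T - X))\<^sup>2"
    using T by (subst frob_norm_diff_sq) (auto simp: X)
  finally show ?thesis .
qed

section \<open>The law of the data\<close>

lemma PiM_density:
  fixes f :: "'i \<Rightarrow> 'a \<Rightarrow> ennreal"
  assumes "finite I" and M: "\<And>i. sigma_finite_measure (M i)"
    and f: "\<And>i. f i \<in> borel_measurable (M i)"
    and Mf: "\<And>i. sigma_finite_measure (density (M i) (f i))"
  shows "density (PiM I M) (\<lambda>x. \<Prod>i\<in>I. f i (x i)) = PiM I (\<lambda>i. density (M i) (f i))"
proof -
  interpret M: product_sigma_finite M using M by (simp add: product_sigma_finite_def)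
  interpret Mf: product_sigma_finite "\<lambda>i. density (M i) (f i)"
    using Mf by (simp add: product_sigma_finite_def)
  note f[measurable]
  show ?thesis
  proof (rule Mf.PiM_eqI)
    show "sets (density (PiM I M) (\<lambda>x. \<Prod>i\<in>I. f i (x i))) = PiM I (\<lambda>i. density (M i) (f i))"
      by (simp cong: sets_PiM_cong)
  next
    fix A assume "\<And>i. i \<in> I \<Longrightarrow> A i \<in> sets (density (M i) (f i))"
    then have A[measurable]: "\<And>i. i \<in> I \<Longrightarrow> A i \<in> sets (M i)" by simp
    have "emeasure (density (PiM I M) (\<lambda>x. \<Prod>i\<in>I. f i (x i))) (Pi\<^sub>E I A) =
        (\<integral>\<^sup>+x. (\<Prod>i\<in>I. f i (x i)) * indicator (Pi\<^sub>E I A) x \<partial>PiM I M)"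
      using assms(1) A by (intro emeasure_density sets_PiM_I_finite) auto
    also have "\<dots> = (\<integral>\<^sup>+x. (\<Prod>i\<in>I. f i (x i) * indicator (A i) (x i)) \<partial>PiM I M)"
    proof (rule nn_integral_cong)
      fix x assume x: "x \<in> space (PiM I M)"
      have "indicator (Pi\<^sub>E I A) x = (\<Prod>i\<in>I. indicator (A i) (x i) :: ennreal)"
      proof (cases "x \<in> Pi\<^sub>E I A")
        case True
        then have "(\<Prod>i\<in>I. indicator (A i) (x i) :: ennreal) = 1"
          by (intro prod.neutral) (auto dest: PiE_mem)
        with True show ?thesis by simp
      next
        case False
        with x obtain i where "i \<in> I" "x i \<notin> A i" by (auto simp: space_PiM PiE_iff)
        then have "(\<Prod>i\<in>I. indicator (A i) (x i) :: ennreal) = 0"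
          using assms(1) by (intro prod_zero bexI[of _ i]) auto
        with False show ?thesis by simp
      qed
      then show "(\<Prod>i\<in>I. f i (x i)) * indicator (Pi\<^sub>E I A) x = (\<Prod>i\<in>I. f i (x i) * indicator (A i) (x i))"
        by (simp add: prod.distrib)
    qed
    also have "\<dots> = (\<Prod>i\<in>I. \<integral>\<^sup>+x. f i x * indicator (A i) x \<partial>M i)"
      using assms(1) A by (intro M.product_nn_integral_prod) auto
    also have "\<dots> = (\<Prod>i\<in>I. emeasure (density (M i) (f i)) (A i))"
      using A by (intro prod.cong) (auto simp: emeasure_density)
    finally show "emeasure (density (PiM I M) (\<lambda>x. \<Prod>i\<in>I. f i (x i))) (Pi\<^sub>E I A) =
        (\<Prod>i\<in>I. emeasure (density (M i) (f i)) (A i))" .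
  qed (fact assms(1))
qed

definition sample_density ::
    "(real \<Rightarrow> real) \<Rightarrow> (real \<Rightarrow> real) \<Rightarrow> real mat \<Rightarrow> (nat \<times> nat) \<times> real \<Rightarrow> real" where
  "sample_density h G X z = h (snd z) * exp (X $$ fst z * snd z - G (X $$ fst z))"

text \<open>
  The geometric mean of two members of the family is proportional to the member at the midpoint of the
  parameters, so the normalising constants give the affinity. For \<open>x = y\<close> this is the statement that the
  density has total mass \<open>1\<close>.
\<close>

lemma affinity_exp_family:
  assumes nef: "natural_exp_family \<nu> h G S" and mid: "(x + y) / 2 \<in> S"
  shows "(\<integral>\<^sup>+z. ennreal (sqrt ((h z * exp (x * z - G x)) * (h z * exp (y * z - G y)))) \<partial>\<nu>) =
    ennreal (exp (G ((x + y) / 2) - ((G x + G y) / 2)))"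
proof -
  have [measurable_cong]: "sets \<nu> = sets borel" and [measurable]: "h \<in> borel_measurable borel"
    and h: "\<And>z. 0 \<le> h z" using nef by (auto simp: natural_exp_family_def)
  have "sqrt ((h z * exp (x * z - G x)) * (h z * exp (y * z - G y))) =
      exp (- ((G x + G y) / 2)) * (h z * exp ((x + y) / 2 * z))" for z
  proof (rule real_sqrt_unique)
    have "(exp (- ((G x + G y) / 2)) * (h z * exp ((x + y) / 2 * z)))\<^sup>2 =
        (h z)\<^sup>2 * exp (2 * (- ((G x + G y) / 2)) + 2 * ((x + y) / 2 * z))"
      unfolding exp_add exp_double power_mult_distrib by simp
    also have "2 * (- ((G x + G y) / 2)) + 2 * ((x + y) / 2 * z) = (x * z - G x) + (y * z - G y)"
    proof -
      have "(x + y) / 2 * z = (x * z + y * z) / 2" by (simp add: distrib_right)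
      moreover have "2 * (- ((a + b) / 2)) + 2 * c = (d - a) + (e - b)" if "c = (d + e) / 2" for a b c d e :: real
        using that by (simp add: add_divide_distrib)
      ultimately show ?thesis by blast
    qed
    also have "(h z)\<^sup>2 * exp ((x * z - G x) + (y * z - G y)) = (h z)\<^sup>2 * (exp (x * z - G x) * exp (y * z - G y))"
      by (simp only: exp_add)
    finally show "(exp (- ((G x + G y) / 2)) * (h z * exp ((x + y) / 2 * z)))\<^sup>2 =
        (h z * exp (x * z - G x)) * (h z * exp (y * z - G y))"
      by (simp add: power2_eq_square ac_simps)
  qed (simp add: h)
  then have "(\<integral>\<^sup>+z. ennreal (sqrt ((h z * exp (x * z - G x)) * (h z * exp (y * z - G y)))) \<partial>\<nu>) =
      (\<integral>\<^sup>+z. ennreal (exp (- ((G x + G y) / 2))) * ennreal (h z * exp ((x + y) / 2 * z)) \<partial>\<nu>)"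
    using h by (simp add: ennreal_mult)
  also have "\<dots> = ennreal (exp (- ((G x + G y) / 2))) * ennreal (exp (G ((x + y) / 2)))"
    using nef mid by (subst nn_integral_cmult) (auto simp: natural_exp_family_def)
  also have "\<dots> = ennreal (exp (G ((x + y) / 2) - ((G x + G y) / 2)))"
    by (simp add: ennreal_mult[symmetric] exp_add[symmetric])
  finally show ?thesis .
qed

lemma prob_space_exp_family_dist:
  assumes nef: "natural_exp_family \<nu> h G S" and "x \<in> S"
  shows "prob_space (exp_family_dist \<nu> h G x)"
proof -
  have [measurable_cong]: "sets \<nu> = sets borel" and [measurable]: "h \<in> borel_measurable borel"
    and h: "\<And>z. 0 \<le> h z" using nef by (auto simp: natural_exp_family_def)
  show ?thesis
    using affinity_exp_family[OF nef, of x x] \<open>x \<in> S\<close> h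
    by (intro prob_spaceI)
      (simp add: exp_family_dist_def emeasure_density abs_mult cong: nn_integral_cong)
qed

text \<open>
  The parameter set \<open>S\<close> is where \<open>G\<close> is known to be the log-partition function; a matrix gives a law of
  the data as soon as its entries at all positions lie in \<open>S\<close>.
\<close>

locale matrix_sampling =
  fixes m1 m2 :: nat and \<pi> :: "(nat \<times> nat) measure" and \<nu> :: "real measure"
    and h G :: "real \<Rightarrow> real" and S :: "real set"
  assumes m: "0 < m1" "0 < m2"
    and \<pi>: "prob_space \<pi>" and sets_\<pi>: "sets \<pi> = sets (count_space ({..<m1} \<times> {..<m2}))"
    and nef: "natural_exp_family \<nu> h G S"
begin

abbreviation positions :: "(nat \<times> nat) set" where
  "positions \<equiv> {..<m1} \<times> {..<m2}"

abbreviation base :: "((nat \<times> nat) \<times> real) measure" where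
  "base \<equiv> \<pi> \<Otimes>\<^sub>M \<nu>"

sublocale index: prob_space \<pi> by (rule \<pi>)

sublocale obs: sigma_finite_measure \<nu> using nef by (simp add: natural_exp_family_def)

lemma sets_\<nu>[measurable_cong]: "sets \<nu> = sets borel"
  using nef by (simp add: natural_exp_family_def)

lemma h_measurable[measurable]: "h \<in> borel_measurable borel"
  using nef by (simp add: natural_exp_family_def)

lemma h_nonneg: "0 \<le> h z"
  using nef by (simp add: natural_exp_family_def)

lemma space_\<pi>: "space \<pi> = positions"
  using sets_eq_imp_space_eq[OF sets_\<pi>] by simp

lemma index_measurable: "(\<And>w. w \<in> positions \<Longrightarrow> f w \<in> space N) \<Longrightarrow> f \<in> measurable \<pi> N"
  using measurable_cong_sets[OF sets_\<pi> refl, of N] by auto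

lemma sigma_finite_base: "sigma_finite_measure base"
proof -
  interpret pair_sigma_finite \<pi> \<nu> ..
  show ?thesis by unfold_locales
qed

lemma sample_density_nonneg: "0 \<le> sample_density h G X z"
  by (simp add: sample_density_def h_nonneg)

lemma sample_density_measurable[measurable]: "sample_density h G X \<in> borel_measurable base"
proof -
  have [measurable]: "(\<lambda>w. X $$ w) \<in> borel_measurable \<pi>" "(\<lambda>w. G (X $$ w)) \<in> borel_measurable \<pi>"
    by (rule index_measurable; simp)+
  show ?thesis unfolding sample_density_def by measurable
qed

lemma sets_data_space: "sets (PiM {..<n} (\<lambda>_. base)) = sets (data_space m1 m2 n)"
  unfolding data_space_def
  by (intro sets_PiM_cong sets_pair_measure_cong sets_\<pi> sets_\<nu> refl)

lemma prob_space_sample: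
  assumes X: "\<forall>w\<in>positions. X $$ w \<in> S"
  shows "prob_space (density base (sample_density h G X))"
proof (rule prob_spaceI)
  have "emeasure (density base (sample_density h G X)) (space (density base (sample_density h G X))) =
      (\<integral>\<^sup>+w. \<integral>\<^sup>+z. sample_density h G X (w, z) \<partial>\<nu> \<partial>\<pi>)"
    by (subst obs.nn_integral_fst) (simp_all add: emeasure_density cong: nn_integral_cong)
  also have "\<dots> = (\<integral>\<^sup>+w. 1 \<partial>\<pi>)"
  proof (rule nn_integral_cong)
    fix w assume "w \<in> space \<pi>"
    then have "X $$ w \<in> S" using X space_\<pi> by blast
    then show "(\<integral>\<^sup>+z. sample_density h G X (w, z) \<partial>\<nu>) = 1"
      using affinity_exp_family[OF nef, of "X $$ w" "X $$ w"] h_nonneg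
      by (simp add: sample_density_def abs_mult)
  qed
  also have "\<dots> = 1" by (simp add: index.emeasure_space_1)
  finally show "emeasure (density base (sample_density h G X))
      (space (density base (sample_density h G X))) = 1" .
qed

text \<open>
  Drawing all positions first and then all observations is the same as drawing \<open>n\<close> independent pairs:
  the two laws agree on boxes, where the integral over the positions factorises.
\<close>

lemma data_law_eq_PiM:
  assumes X: "\<forall>w\<in>positions. X $$ w \<in> S"
  shows "data_law m1 m2 n \<pi> \<nu> h G X = PiM {..<n} (\<lambda>_. density base (sample_density h G X))"
proof -
  let ?I = "{..<n}" and ?D = "data_space m1 m2 n" and ?f = "sample_density h G X"
  let ?Q = "\<lambda>w. exp_family_dist \<nu> h G (X $$ w)"
  let ?J = "\<lambda>(\<omega> :: nat \<Rightarrow> nat \<times> nat) (Y :: nat \<Rightarrow> real). \<lambda>i\<in>?I. (\<omega> i, Y i)"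
  interpret \<pi>s: product_sigma_finite "\<lambda>_::nat. \<pi>"
    by (simp add: product_sigma_finite_def index.sigma_finite_measure_axioms)
  interpret K: prob_space "density base ?f" by (rule prob_space_sample[OF X])
  interpret Ks: product_sigma_finite "\<lambda>_::nat. density base ?f"
    by (simp add: product_sigma_finite_def K.sigma_finite_measure_axioms)
  interpret \<pi>n: prob_space "PiM ?I (\<lambda>_. \<pi>)" by (intro prob_space_PiM \<pi>)
  have sets_Q[measurable_cong]: "sets (?Q w) = sets borel" for w
    by (simp add: exp_family_dist_def sets_\<nu>)
  \<comment> \<open>The indices range over all of \<open>nat\<close> here, so \<open>\<omega> i\<close> may be outside the matrix; sigma-finiteness holds for every parameter.\<close>
  have Qs: "product_sigma_finite (\<lambda>i::nat. ?Q (\<omega> i))" for \<omega>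
    unfolding product_sigma_finite_def exp_family_dist_def
    by (intro allI, subst obs.sigma_finite_iff_density_finite) auto
  have \<omega>_pos: "\<omega> i \<in> positions" if "\<omega> \<in> space (PiM ?I (\<lambda>_. \<pi>))" "i \<in> ?I" for \<omega> i
    using that by (auto simp: space_PiM space_\<pi> dest: PiE_mem)
  have Q_prob: "prob_space (PiM ?I (\<lambda>i. ?Q (\<omega> i)))" if "\<omega> \<in> space (PiM ?I (\<lambda>_. \<pi>))" for \<omega>
    using bspec[OF X \<omega>_pos[OF that]] by (intro prob_space_PiM prob_space_exp_family_dist[OF nef]) auto
  have J: "?J \<omega> \<in> measurable (PiM ?I (\<lambda>i. ?Q (\<omega> i))) ?D"
    if "\<omega> \<in> space (PiM ?I (\<lambda>_. \<pi>))" for \<omega>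
  proof -
    have "(\<lambda>Y. Y i) \<in> borel_measurable (PiM ?I (\<lambda>i. ?Q (\<omega> i)))" if "i \<in> ?I" for i
      using measurable_component_singleton[OF that, of "\<lambda>i. ?Q (\<omega> i)"]
      unfolding measurable_cong_sets[OF refl sets_Q] .
    then show ?thesis
      unfolding data_space_def using \<omega>_pos[OF that]
      by (intro measurable_restrict measurable_Pair measurable_const) auto
  qed
  \<comment> \<open>Positions are discrete, so every function of the position vector is measurable, and the kernel in particular.\<close>
  have sets_\<pi>n: "sets (PiM ?I (\<lambda>_. \<pi>)) = sets (count_space (?I \<rightarrow>\<^sub>E positions))"
    by (subst count_space_PiM_finite[symmetric]) (auto intro!: sets_PiM_cong sets_\<pi> countable_finite)
  let ?N = "\<lambda>\<omega>. distr (PiM ?I (\<lambda>i. ?Q (\<omega> i))) ?D (?J \<omega>)"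
  have law: "data_law m1 m2 n \<pi> \<nu> h G X = PiM ?I (\<lambda>_. \<pi>) \<bind> ?N"
    unfolding data_law_def
    using prob_space.not_empty[OF Q_prob] J by (intro bind_cong_All ballI bind_return_distr')
  have N: "?N \<in> measurable (PiM ?I (\<lambda>_. \<pi>)) (subprob_algebra ?D)"
    unfolding measurable_cong_sets[OF sets_\<pi>n refl]
  proof (subst measurable_count_space_eq1, intro PiE_I Pi_I)
    fix \<omega> assume "\<omega> \<in> ?I \<rightarrow>\<^sub>E positions"
    then have \<omega>: "\<omega> \<in> space (PiM ?I (\<lambda>_. \<pi>))" by (simp add: space_PiM space_\<pi>)
    show "?N \<omega> \<in> space (subprob_algebra ?D)"
      using prob_space.prob_space_distr[OF Q_prob[OF \<omega>] J[OF \<omega>]]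
      by (simp add: space_subprob_algebra prob_space_imp_subprob_space)
  qed
  show ?thesis unfolding law
  proof (rule Ks.PiM_eqI)
    have "sets (PiM ?I (\<lambda>_. \<pi>) \<bind> ?N) = sets ?D"
      using \<pi>n.not_empty by simp
    also have "\<dots> = sets (PiM ?I (\<lambda>_. density base ?f))"
      unfolding sets_data_space[symmetric] by (intro sets_PiM_cong) auto
    finally show "sets (PiM ?I (\<lambda>_. \<pi>) \<bind> ?N) = PiM ?I (\<lambda>_. density base ?f)" .
  next
    fix A assume "\<And>i. i \<in> ?I \<Longrightarrow> A i \<in> sets (density base ?f)"
    then have A[measurable]: "\<And>i. i \<in> ?I \<Longrightarrow> A i \<in> sets base" by simp
    have Abox: "Pi\<^sub>E ?I A \<in> sets ?D"
      unfolding sets_data_space[symmetric] using A by (intro sets_PiM_I_finite) auto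
    have slice: "Pair w -` A i \<in> sets borel" if "i \<in> ?I" for i w
      using sets_Pair1[OF A[OF that], of w] sets_\<nu> by simp
    have box: "emeasure (?N \<omega>) (Pi\<^sub>E ?I A) = (\<Prod>i\<in>?I. emeasure (?Q (\<omega> i)) (Pair (\<omega> i) -` A i))"
      if "\<omega> \<in> space (PiM ?I (\<lambda>_. \<pi>))" for \<omega>
    proof -
      interpret Q: product_sigma_finite "\<lambda>i::nat. ?Q (\<omega> i)" by (rule Qs)
      have "?J \<omega> -` Pi\<^sub>E ?I A \<inter> space (PiM ?I (\<lambda>i. ?Q (\<omega> i))) = Pi\<^sub>E ?I (\<lambda>i. Pair (\<omega> i) -` A i)"
        by (auto simp: space_PiM sets_eq_imp_space_eq[OF sets_Q] PiE_iff)
      then have "emeasure (?N \<omega>) (Pi\<^sub>E ?I A) =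
          emeasure (PiM ?I (\<lambda>i. ?Q (\<omega> i))) (Pi\<^sub>E ?I (\<lambda>i. Pair (\<omega> i) -` A i))"
        by (simp only: emeasure_distr[OF J[OF that] Abox])
      also have "\<dots> = (\<Prod>i\<in>?I. emeasure (?Q (\<omega> i)) (Pair (\<omega> i) -` A i))"
        by (intro Q.emeasure_PiM) (simp_all only: sets_Q slice finite_lessThan)
      finally show ?thesis .
    qed
    have Qslice: "emeasure (?Q w) (Pair w -` A i) = (\<integral>\<^sup>+z. ennreal (?f (w, z)) * indicator (A i) (w, z) \<partial>\<nu>)"
      if "i \<in> ?I" for i w
      unfolding exp_family_dist_def using slice[OF that, of w]
      by (subst emeasure_density)
        (auto simp: sets_\<nu> sample_density_def indicator_def intro!: nn_integral_cong)
    have "emeasure (PiM ?I (\<lambda>_. \<pi>) \<bind> ?N) (Pi\<^sub>E ?I A) = (\<integral>\<^sup>+\<omega>. emeasure (?N \<omega>) (Pi\<^sub>E ?I A) \<partial>PiM ?I (\<lambda>_. \<pi>))"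
      by (rule emeasure_bind[OF \<pi>n.not_empty N Abox])
    also have "\<dots> = (\<integral>\<^sup>+\<omega>. (\<Prod>i\<in>?I. \<integral>\<^sup>+z. ennreal (?f (\<omega> i, z)) * indicator (A i) (\<omega> i, z) \<partial>\<nu>) \<partial>PiM ?I (\<lambda>_. \<pi>))"
      using box Qslice by (intro nn_integral_cong) (auto intro!: prod.cong)
    also have "\<dots> = (\<Prod>i\<in>?I. \<integral>\<^sup>+w. \<integral>\<^sup>+z. ennreal (?f (w, z)) * indicator (A i) (w, z) \<partial>\<nu> \<partial>\<pi>)"
      by (intro \<pi>s.product_nn_integral_prod index_measurable) auto
    also have "\<dots> = (\<Prod>i\<in>?I. emeasure (density base ?f) (A i))"
    proof (rule prod.cong)
      fix i assume i: "i \<in> ?I"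
      note [measurable] = A[OF i]
      have "(\<integral>\<^sup>+w. \<integral>\<^sup>+z. ennreal (?f (w, z)) * indicator (A i) (w, z) \<partial>\<nu> \<partial>\<pi>) =
          (\<integral>\<^sup>+x. ennreal (?f x) * indicator (A i) x \<partial>base)"
        by (rule obs.nn_integral_fst) measurable
      then show "(\<integral>\<^sup>+w. \<integral>\<^sup>+z. ennreal (?f (w, z)) * indicator (A i) (w, z) \<partial>\<nu> \<partial>\<pi>) = emeasure (density base ?f) (A i)"
        by (simp add: emeasure_density)
    qed simp
    finally show "emeasure (PiM ?I (\<lambda>_. \<pi>) \<bind> ?N) (Pi\<^sub>E ?I A) = (\<Prod>i\<in>?I. emeasure (density base ?f) (A i))" .
  qed simp
qed

lemma prob_space_data_law:
  assumes X: "\<forall>w\<in>positions. X $$ w \<in> S"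
  shows "prob_space (data_law m1 m2 n \<pi> \<nu> h G X)"
  using data_law_eq_PiM[OF X] by (simp add: prob_space_PiM prob_space_sample X)

lemma data_law_eq_density:
  assumes X: "\<forall>w\<in>positions. X $$ w \<in> S"
  shows "data_law m1 m2 n \<pi> \<nu> h G X =
    density (PiM {..<n} (\<lambda>_. base)) (\<lambda>d. ennreal (\<Prod>i<n. sample_density h G X (d i)))"
proof -
  have "sigma_finite_measure (density base (sample_density h G X))"
    using prob_space_sample[OF X] by (simp add: prob_space_imp_sigma_finite)
  then show ?thesis
    using data_law_eq_PiM[OF X, of n]
      PiM_density[of "{..<n}" "\<lambda>_. base" "\<lambda>_ z. ennreal (sample_density h G X z)"]
    by (simp add: sigma_finite_base prod_ennreal sample_density_nonneg)
qed

text \<open>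
  A sampled position outside \<open>B\<close> carries no information about which of the two matrices is the true one
  and contributes affinity \<open>1\<close>. The truncation at \<open>1\<close> keeps the bound nonnegative whatever the size of
  \<open>u\<close>, so that powers of it can be compared.
\<close>

lemma sample_affinity_ge:
  assumes B: "B \<subseteq> positions"
    and off: "\<And>w. w \<in> positions - B \<Longrightarrow> X $$ w = X' $$ w \<and> X $$ w \<in> S"
    and on: "\<And>w. w \<in> B \<Longrightarrow> (X $$ w + X' $$ w) / 2 \<in> S \<and>
      (G (X $$ w) + G (X' $$ w)) / 2 - G ((X $$ w + X' $$ w) / 2) \<le> u"
    and u: "0 \<le> u"
  shows "ennreal (1 - min 1 u * measure \<pi> B) \<le>
    (\<integral>\<^sup>+z. ennreal (sqrt (sample_density h G X z * sample_density h G X' z)) \<partial>base)"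
proof -
  have [measurable]: "B \<in> sets \<pi>" using B sets_\<pi> by simp
  have "ennreal (1 - min 1 u * measure \<pi> B) = ennreal (\<integral>w. 1 - min 1 u * indicator B w \<partial>\<pi>)"
    by (subst Bochner_Integration.integral_diff)
      (auto simp: index.prob_space integrable_indicator_iff index.emeasure_eq_measure)
  also have "\<dots> = (\<integral>\<^sup>+w. ennreal (1 - min 1 u * indicator B w) \<partial>\<pi>)"
  proof (rule nn_integral_eq_integral[symmetric])
    have "integrable \<pi> (indicator B :: _ \<Rightarrow> real)"
      by (rule integrable_real_indicator) (auto simp: index.emeasure_eq_measure)
    then show "integrable \<pi> (\<lambda>w. 1 - min 1 u * indicator B w)"
      by (intro Bochner_Integration.integrable_diff integrable_mult_right index.integrable_const)
  qed (auto simp: indicator_def)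
  also have "\<dots> \<le> (\<integral>\<^sup>+w. \<integral>\<^sup>+z. sqrt (sample_density h G X (w, z) * sample_density h G X' (w, z)) \<partial>\<nu> \<partial>\<pi>)"
  proof (rule nn_integral_mono)
    fix w assume "w \<in> space \<pi>"
    then have w: "w \<in> positions" by (simp add: space_\<pi>)
    have mid: "(X $$ w + X' $$ w) / 2 \<in> S"
      using on[of w] off[of w] w by (cases "w \<in> B") auto
    have "1 - min 1 u * indicator B w \<le>
        exp (G ((X $$ w + X' $$ w) / 2) - (G (X $$ w) + G (X' $$ w)) / 2)"
    proof (cases "w \<in> B")
      case True
      let ?e = "G ((X $$ w + X' $$ w) / 2) - (G (X $$ w) + G (X' $$ w)) / 2"
      have "1 - u \<le> exp ?e"
        using on[OF True] exp_ge_add_one_self[of ?e] by linarith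
      then have "1 - min 1 u \<le> exp ?e"
        using exp_ge_zero[of ?e] by (simp add: min_def)
      then show ?thesis using True by simp
    next
      case False
      then show ?thesis using off[of w] w by simp
    qed
    then show "ennreal (1 - min 1 u * indicator B w) \<le>
        (\<integral>\<^sup>+z. sqrt (sample_density h G X (w, z) * sample_density h G X' (w, z)) \<partial>\<nu>)"
      using affinity_exp_family[OF nef mid] by (simp add: sample_density_def ennreal_leI)
  qed
  also have "\<dots> = (\<integral>\<^sup>+z. ennreal (sqrt (sample_density h G X z * sample_density h G X' z)) \<partial>base)"
    by (rule obs.nn_integral_fst) measurable
  finally show ?thesis .
qed

text \<open>
  Affinities of independent samples multiply, and the resulting power is linearised by Bernoulli's
  inequality.
\<close>

lemma data_affinity_ge:
  assumes "B \<subseteq> positions"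
    and "\<And>w. w \<in> positions - B \<Longrightarrow> X $$ w = X' $$ w \<and> X $$ w \<in> S"
    and "\<And>w. w \<in> B \<Longrightarrow> (X $$ w + X' $$ w) / 2 \<in> S \<and>
      (G (X $$ w) + G (X' $$ w)) / 2 - G ((X $$ w + X' $$ w) / 2) \<le> u"
    and u: "0 \<le> u"
  shows "ennreal (1 - real n * (u * measure \<pi> B)) \<le>
    (\<integral>\<^sup>+d. ennreal (sqrt ((\<Prod>i<n. sample_density h G X (d i)) * (\<Prod>i<n. sample_density h G X' (d i))))
      \<partial>PiM {..<n} (\<lambda>_. base))"
proof -
  interpret product_sigma_finite "\<lambda>_::nat. base"
    by (simp add: product_sigma_finite_def sigma_finite_base)
  let ?\<delta> = "min 1 u * measure \<pi> B"
  have \<delta>: "0 \<le> ?\<delta>" "?\<delta> \<le> 1" "?\<delta> \<le> u * measure \<pi> B"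
    using u index.prob_le_1[of B] mult_mono[of "min 1 u" 1 "measure \<pi> B" 1]
    by (auto intro: mult_right_mono)
  have "1 - real n * (u * measure \<pi> B) \<le> 1 + real n * (- ?\<delta>)"
    using mult_left_mono[OF \<delta>(3), of "real n"] by simp
  also have "\<dots> \<le> (1 + - ?\<delta>) ^ n"
    using \<delta> by (intro Bernoulli_inequality) simp
  finally have "ennreal (1 - real n * (u * measure \<pi> B)) \<le> ennreal ((1 - ?\<delta>) ^ n)"
    by (intro ennreal_leI) simp
  also have "\<dots> = ennreal (1 - ?\<delta>) ^ n"
    using \<delta> by (simp add: ennreal_power)
  also have "\<dots> \<le> (\<integral>\<^sup>+z. ennreal (sqrt (sample_density h G X z * sample_density h G X' z)) \<partial>base) ^ n"
    by (intro power_mono sample_affinity_ge assms) auto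
  also have "\<dots> = (\<integral>\<^sup>+d. (\<Prod>i<n. ennreal (sqrt (sample_density h G X (d i) * sample_density h G X' (d i))))
      \<partial>PiM {..<n} (\<lambda>_. base))"
    by (subst product_nn_integral_prod) auto
  also have "\<dots> = (\<integral>\<^sup>+d. ennreal (sqrt ((\<Prod>i<n. sample_density h G X (d i)) * (\<Prod>i<n. sample_density h G X' (d i))))
      \<partial>PiM {..<n} (\<lambda>_. base))"
  proof (rule nn_integral_cong)
    fix d
    have sqrt_prod: "sqrt (\<Prod>i<n. f i) = (\<Prod>i<n. sqrt (f i))" for f :: "nat \<Rightarrow> real"
      by (induction n) (auto simp: real_sqrt_mult)
    show "(\<Prod>i<n. ennreal (sqrt (sample_density h G X (d i) * sample_density h G X' (d i)))) =
      ennreal (sqrt ((\<Prod>i<n. sample_density h G X (d i)) * (\<Prod>i<n. sample_density h G X' (d i))))"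
      by (simp add: prod_ennreal prod.distrib real_sqrt_mult sqrt_prod sample_density_nonneg)
  qed
  finally show ?thesis .
qed

end

section \<open>Curvature of the log-partition function\<close>

text \<open>
  Subtracting \<open>\<sigma>hi\<^sup>2 x\<^sup>2 / 2\<close> from \<open>G\<close> leaves a concave function, which lies at \<open>0\<close> above its chord
  between \<open>- \<kappa>\<close> and \<open>\<kappa>\<close>. The strict inequality \<open>\<kappa> < \<gamma>\<close> keeps both points in the open interval, where the
  one-sided derivatives are derivatives.
\<close>

lemma midpoint_gap_le:
  fixes G :: "real \<Rightarrow> real"
  assumes G: "second_deriv_bounds G {-\<gamma>..\<gamma>} \<sigma>lo \<sigma>hi" and "0 \<le> \<kappa>" "\<kappa> < \<gamma>"
  shows "(G \<kappa> + G (- \<kappa>)) / 2 - G 0 \<le> \<sigma>hi\<^sup>2 * \<kappa>\<^sup>2 / 2"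
proof -
  obtain G' G'' where G': "\<And>x. x \<in> {-\<gamma>..\<gamma>} \<Longrightarrow> (G has_real_derivative G' x) (at x within {-\<gamma>..\<gamma>})"
    and G'': "\<And>x. x \<in> {-\<gamma>..\<gamma>} \<Longrightarrow> (G' has_real_derivative G'' x) (at x within {-\<gamma>..\<gamma>})"
    and le: "\<And>x. x \<in> {-\<gamma>..\<gamma>} \<Longrightarrow> G'' x \<le> \<sigma>hi\<^sup>2"
    using G unfolding second_deriv_bounds_def by blast
  have within: "at x within {-\<gamma>..\<gamma>} = at x" if "x \<in> {-\<gamma><..<\<gamma>}" for x :: real
    using that by (intro at_within_interior) (simp add: interior_atLeastAtMost_real)
  have D: "(G has_real_derivative G' x) (at x)" "(G' has_real_derivative G'' x) (at x)" "G'' x \<le> \<sigma>hi\<^sup>2"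
    if "x \<in> {-\<gamma><..<\<gamma>}" for x
    using G'[of x] G''[of x] le[of x] within[OF that] that by auto
  have "concave_on {-\<gamma><..<\<gamma>} (\<lambda>x. G x - \<sigma>hi\<^sup>2 * x\<^sup>2 / 2)"
    by (rule f''_le0_imp_concave[where f' = "\<lambda>x. G' x - \<sigma>hi\<^sup>2 * x" and f'' = "\<lambda>x. G'' x - \<sigma>hi\<^sup>2"])
      (auto intro!: derivative_eq_intros D simp: D)
  then have "convex_on {-\<gamma><..<\<gamma>} (\<lambda>x. - (G x - \<sigma>hi\<^sup>2 * x\<^sup>2 / 2))"
    by (simp add: concave_on_def)
  from convex_onD[OF this, of "1 / 2" "- \<kappa>" \<kappa>] \<open>0 \<le> \<kappa>\<close> \<open>\<kappa> < \<gamma>\<close>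
  show ?thesis by (simp add: field_simps)
qed

section \<open>Sign patterns and estimators\<close>

lemma sum_fibre_weights:
  fixes p :: "'b \<Rightarrow> real"
  assumes "finite W" "finite A" "lab ` W \<subseteq> A" "\<And>a. a \<in> A \<Longrightarrow> 0 \<le> p a"
    and "\<And>a. real (card {w\<in>W. lab w = a}) \<le> K"
  shows "(\<Sum>w\<in>W. p (lab w)) \<le> K * (\<Sum>a\<in>A. p a)"
proof -
  have "(\<Sum>w\<in>W. p (lab w)) = (\<Sum>a\<in>A. \<Sum>w\<in>{w\<in>W. lab w = a}. p (lab w))"
    using assms by (intro sum.group[symmetric]) auto
  also have "\<dots> = (\<Sum>a\<in>A. real (card {w\<in>W. lab w = a}) * p a)"
    by (intro sum.cong) auto
  also have "\<dots> \<le> (\<Sum>a\<in>A. K * p a)"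
    using assms by (intro sum_mono mult_right_mono) auto
  finally show ?thesis by (simp add: sum_distrib_left)
qed

context matrix_sampling
begin

text \<open>
  The left-hand side is \<open>((1 - n u \<pi>(B)) - 1/4) / 2\<close>, the testing bound for the affinity of \<open>n\<close> samples.
\<close>

lemma data_testing_error_ge:
  assumes B: "B \<subseteq> positions"
    and X: "\<forall>w\<in>positions. X $$ w \<in> S" and X': "\<forall>w\<in>positions. X' $$ w \<in> S"
    and off: "\<And>w. w \<in> positions - B \<Longrightarrow> X $$ w = X' $$ w"
    and on: "\<And>w. w \<in> B \<Longrightarrow> (X $$ w + X' $$ w) / 2 \<in> S \<and>
      (G (X $$ w) + G (X' $$ w)) / 2 - G ((X $$ w + X' $$ w) / 2) \<le> u"
    and u: "0 \<le> u" and E: "E \<in> sets (data_space m1 m2 n)"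
  shows "3 / 8 - real n * (u * measure \<pi> B) / 2 \<le> measure (data_law m1 m2 n \<pi> \<nu> h G X) E +
    measure (data_law m1 m2 n \<pi> \<nu> h G X') (space (data_space m1 m2 n) - E)"
proof -
  let ?R = "PiM {..<n} (\<lambda>_. base)"
  have [measurable]: "(\<lambda>d. \<Prod>i<n. sample_density h G Z (d i)) \<in> borel_measurable ?R" for Z
    by measurable
  have sp: "space ?R = space (data_space m1 m2 n)"
    by (rule sets_eq_imp_space_eq[OF sets_data_space])
  have "((1 - real n * (u * measure \<pi> B)) - 1 / 4) / 2 \<le> measure (data_law m1 m2 n \<pi> \<nu> h G X) E +
    measure (data_law m1 m2 n \<pi> \<nu> h G X') (space ?R - E)"
    unfolding data_law_eq_density[OF X] data_law_eq_density[OF X']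
  proof (rule testing_error_ge_affinity)
    show "E \<in> sets ?R" using E sets_data_space by simp
    show "prob_space (density ?R (\<lambda>d. ennreal (\<Prod>i<n. sample_density h G X (d i))))"
      using prob_space_data_law[OF X] data_law_eq_density[OF X] by simp
    show "prob_space (density ?R (\<lambda>d. ennreal (\<Prod>i<n. sample_density h G X' (d i))))"
      using prob_space_data_law[OF X'] data_law_eq_density[OF X'] by simp
    show "ennreal (1 - real n * (u * measure \<pi> B)) \<le> (\<integral>\<^sup>+d. ennreal (sqrt
        ((\<Prod>i<n. sample_density h G X (d i)) * (\<Prod>i<n. sample_density h G X' (d i)))) \<partial>?R)"
      using off on X by (intro data_affinity_ge B u) blast+
  qed (auto intro!: prod_nonneg simp: sample_density_nonneg)
  then show ?thesis unfolding sp by (simp add: diff_divide_distrib)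
qed

lemma sets_data_law:
  assumes "\<forall>w\<in>positions. X $$ w \<in> S"
  shows "sets (data_law m1 m2 n \<pi> \<nu> h G X) = sets (data_space m1 m2 n)"
  unfolding data_law_eq_density[OF assms] using sets_data_space by simp

text \<open>
  Whatever signs are guessed from the data, some sign pattern is missed at more than a sixteenth of the
  positions with probability at least \<open>1/16\<close>. Without any information, half of all signs would be wrong
  on average. The condition on \<open>n u K\<close> says that the observations, shared among all labels, are too few
  to improve this by more than a constant: a label occupies at most \<open>K\<close> positions, so the terms
  \<open>n u \<pi>(B a)\<close> contribute at most \<open>n u K\<close> to the sum over the positions.
\<close>

lemma sign_pattern_error:
  fixes lab :: "nat \<times> nat \<Rightarrow> 'l" and \<kappa> u K :: real
  defines "X \<equiv> \<lambda>P. mat m1 m2 (\<lambda>w. if lab w \<in> P then \<kappa> else - \<kappa>)"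
  assumes S: "\<kappa> \<in> S" "- \<kappa> \<in> S" "0 \<in> S" and u: "0 \<le> u" "(G \<kappa> + G (- \<kappa>)) / 2 - G 0 \<le> u"
    and K: "\<And>a. real (card {w \<in> positions. lab w = a}) \<le> K"
    and small: "4 * (real n * u * K) \<le> real m1 * real m2"
    and \<phi>: "\<And>w. w \<in> positions \<Longrightarrow> \<phi> w \<in> sets (data_space m1 m2 n)"
  shows "\<exists>P. 1 / 16 \<le> measure (data_law m1 m2 n \<pi> \<nu> h G (X P))
      {d \<in> space (data_space m1 m2 n). real m1 * real m2 / 16 <
        real (card {w \<in> positions. (d \<in> \<phi> w) \<noteq> (lab w \<in> P)})}"
proof -
  let ?W = positions and ?B = "\<lambda>a. {w \<in> positions. lab w = a}"
  define t where "t a = 3 / 8 - real n * (u * measure \<pi> (?B a)) / 2" for a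
  have XS: "\<forall>w\<in>positions. X P $$ w \<in> S" for P
    using S by (auto simp: X_def)
  have entry: "X P $$ w = (if lab w \<in> P then \<kappa> else - \<kappa>)" if "w \<in> positions" for P w
    using that by (auto simp: X_def)
  have cardW: "real (card ?W) = real m1 * real m2" by simp
  have "\<exists>P\<subseteq>lab ` ?W. (\<Sum>w\<in>?W. t (lab w)) / 2 \<le> real (card ?W) *
      measure (data_law m1 m2 n \<pi> \<nu> h G (X P))
        {d \<in> space (data_space m1 m2 n). 1 / 16 * real (card ?W) <
          real (card {w\<in>?W. (d \<in> \<phi> w) \<noteq> (lab w \<in> P)})} + 1 / 16 * real (card ?W)"
  proof (rule assouad_in_probability)
    fix a P E assume a: "a \<in> lab ` ?W" and P: "P \<subseteq> lab ` ?W - {a}" and E: "E \<in> sets (data_space m1 m2 n)"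
    show "t a \<le> measure (data_law m1 m2 n \<pi> \<nu> h G (X P)) E +
        measure (data_law m1 m2 n \<pi> \<nu> h G (X (insert a P))) (space (data_space m1 m2 n) - E)"
      unfolding t_def
    proof (rule data_testing_error_ge[OF _ XS XS _ _ u(1) E])
      fix w assume w: "w \<in> ?B a"
      with P have "X P $$ w = - \<kappa>" "X (insert a P) $$ w = \<kappa>"
        by (auto simp: entry simp del: mem_Sigma_iff)
      then show "(X P $$ w + X (insert a P) $$ w) / 2 \<in> S \<and>
          (G (X P $$ w) + G (X (insert a P) $$ w)) / 2 - G ((X P $$ w + X (insert a P) $$ w) / 2) \<le> u"
        using S u by (simp add: add.commute)
    next
      fix w assume "w \<in> positions - ?B a"
      then show "X P $$ w = X (insert a P) $$ w" by (auto simp: entry simp del: mem_Sigma_iff)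
    qed auto
  qed (auto simp: prob_space_data_law sets_data_law XS \<phi> simp del: mem_Sigma_iff)
  then obtain P where P: "(\<Sum>w\<in>?W. t (lab w)) / 2 \<le> real m1 * real m2 *
      measure (data_law m1 m2 n \<pi> \<nu> h G (X P))
        {d \<in> space (data_space m1 m2 n). real m1 * real m2 / 16 <
          real (card {w\<in>?W. (d \<in> \<phi> w) \<noteq> (lab w \<in> P)})} + real m1 * real m2 / 16"
    unfolding cardW by auto
  have fibres: "(\<Sum>a\<in>lab ` ?W. measure \<pi> (?B a)) = 1"
  proof -
    have "?B a \<in> sets \<pi>" for a by (auto simp: sets_\<pi>)
    then have "?B ` lab ` ?W \<subseteq> sets \<pi>" by blast
    moreover have "disjoint_family_on ?B (lab ` ?W)" unfolding disjoint_family_on_def by blast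
    ultimately have "(\<Sum>a\<in>lab ` ?W. measure \<pi> (?B a)) = measure \<pi> (\<Union>a\<in>lab ` ?W. ?B a)"
      using index.finite_measure_finite_Union[of "lab ` ?W" ?B] by simp
    also have "(\<Union>a\<in>lab ` ?W. ?B a) = space \<pi>" by (auto simp: space_\<pi>)
    finally show ?thesis by (simp add: index.prob_space)
  qed
  have "(\<Sum>w\<in>?W. measure \<pi> (?B (lab w))) \<le> K * (\<Sum>a\<in>lab ` ?W. measure \<pi> (?B a))"
    by (rule sum_fibre_weights[where p = "\<lambda>a. measure \<pi> (?B a)"]) (use K in auto)
  then have "real n * u * (\<Sum>w\<in>?W. measure \<pi> (?B (lab w))) \<le> real n * u * K"
    using u fibres by (intro mult_left_mono) auto
  moreover have "(\<Sum>w\<in>?W. t (lab w)) = 3 / 8 * (real m1 * real m2) -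
      real n * u * (\<Sum>w\<in>?W. measure \<pi> (?B (lab w))) / 2"
    unfolding t_def sum_subtractf sum_distrib_left sum_divide_distrib by (simp add: mult.assoc)
  ultimately have "(real m1 * real m2) * (1 / 8) \<le> (\<Sum>w\<in>?W. t (lab w)) / 2"
    using small by (simp add: field_simps)
  with P have "(real m1 * real m2) * (1 / 16) \<le> real m1 * real m2 *
      measure (data_law m1 m2 n \<pi> \<nu> h G (X P))
        {d \<in> space (data_space m1 m2 n). real m1 * real m2 / 16 <
          real (card {w\<in>?W. (d \<in> \<phi> w) \<noteq> (lab w \<in> P)})}"
    by simp
  then show ?thesis
    using m by (subst (asm) mult_le_cancel_left_pos) auto
qed

text \<open>
  The choice of \<open>\<kappa>\<close> balances two demands. The entries must lie in \<open>{-\<gamma><..<\<gamma>}\<close>, which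
  \<open>\<kappa> \<le> \<gamma> / 2\<close> guarantees, and \<open>n \<sigma>hi\<^sup>2 \<kappa>\<^sup>2 \<le> M r / 4\<close> keeps neighbouring sign patterns
  indistinguishable on average, since a label occupies at most \<open>2 m1 m2 / (M r)\<close> positions.
\<close>

lemma estimator_error_ge:
  fixes \<gamma> \<sigma>lo \<sigma>hi :: real
  assumes S: "S = {-\<gamma>..\<gamma>}" and "1 \<le> r" "r \<le> min m1 m2" "1 \<le> n" "0 < \<gamma>" "0 < \<sigma>hi"
    and G: "second_deriv_bounds G {-\<gamma>..\<gamma>} \<sigma>lo \<sigma>hi" and T: "T \<in> estimators m1 m2 n"
  shows "\<exists>X\<in>low_rank_class m1 m2 r \<gamma>. 1 / 16 \<le> measure (data_law m1 m2 n \<pi> \<nu> h G X)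
         {d \<in> space (data_space m1 m2 n).
            (mat_frob_norm (T d - X))\<^sup>2 / (real m1 * real m2) >
              1 / 64 * min (\<gamma>\<^sup>2) (real (max m1 m2) * real r / (real n * \<sigma>hi\<^sup>2))}"
proof -
  define L where "L = min (\<gamma>\<^sup>2) (real (max m1 m2) * real r / (real n * \<sigma>hi\<^sup>2))"
  define \<kappa> where "\<kappa> = sqrt L / 2"
  define D where "D = data_space m1 m2 n"
  have pos: "0 < real (max m1 m2) * real r" "0 < real n * \<sigma>hi\<^sup>2"
    using assms m by (simp_all add: less_max_iff_disj)
  have "0 < L" using divide_pos_pos[OF pos] \<open>0 < \<gamma>\<close> by (simp add: L_def)
  then have \<kappa>: "0 < \<kappa>" "\<kappa>\<^sup>2 = L / 4" by (simp_all add: \<kappa>_def power_divide)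
  have "sqrt L \<le> \<gamma>" using \<open>0 < \<gamma>\<close> by (intro real_le_lsqrt) (simp_all add: L_def)
  then have "\<kappa> < \<gamma>" using \<open>0 < \<gamma>\<close> by (simp add: \<kappa>_def)
  define u where "u = \<sigma>hi\<^sup>2 * \<kappa>\<^sup>2 / 2"
  have u: "0 \<le> u" "(G \<kappa> + G (- \<kappa>)) / 2 - G 0 \<le> u"
    using midpoint_gap_le[OF G less_imp_le[OF \<kappa>(1)] \<open>\<kappa> < \<gamma>\<close>] by (simp_all only: u_def) simp
  obtain lab :: "nat \<times> nat \<Rightarrow> nat \<times> nat"
    where fibre: "\<And>a. card {w \<in> positions. lab w = a} * (max m1 m2 * r) \<le> 2 * (m1 * m2)"
      and rank: "\<And>P (x::real) y. vec_space.rank m1 (mat m1 m2 (\<lambda>w. if lab w \<in> P then x else y)) \<le> r"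
    using low_rank_labelling[OF assms(2,3)] by blast
  let ?K = "2 * (real m1 * real m2) / (real (max m1 m2) * real r)"
  have K: "real (card {w \<in> positions. lab w = a}) \<le> ?K" for a
  proof -
    have "real (card {w \<in> positions. lab w = a} * (max m1 m2 * r)) \<le> real (2 * (m1 * m2))"
      by (intro of_nat_mono fibre)
    then show ?thesis
      using pos(1) by (subst pos_le_divide_eq) simp_all
  qed
  have "real n * \<sigma>hi\<^sup>2 * L \<le> real (max m1 m2) * real r"
  proof -
    have "L \<le> real (max m1 m2) * real r / (real n * \<sigma>hi\<^sup>2)" by (simp add: L_def)
    then show ?thesis unfolding pos_le_divide_eq[OF pos(2)] by (simp only: mult.commute)
  qed
  then have "4 * (real n * u * ?K) \<le> real m1 * real m2"
    using pos(1) m by (simp add: u_def \<kappa> field_simps)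
  define \<phi> where "\<phi> w = {d \<in> space D. 0 < T d $$ w}" for w
  have Tm[measurable]: "(\<lambda>d. T d $$ w) \<in> borel_measurable D" if "w \<in> positions" for w
    using T that by (cases w) (auto simp: estimators_def D_def)
  have \<phi>: "\<phi> w \<in> sets D" if "w \<in> positions" for w
    using Tm[OF that] unfolding \<phi>_def by measurable
  define X where "X P = mat m1 m2 (\<lambda>w. if lab w \<in> P then \<kappa> else - \<kappa>)" for P
  obtain P where P: "1 / 16 \<le> measure (data_law m1 m2 n \<pi> \<nu> h G (X P))
      {d \<in> space D. real m1 * real m2 / 16 < real (card {w \<in> positions. (d \<in> \<phi> w) \<noteq> (lab w \<in> P)})}"
    using sign_pattern_error[of \<kappa> u lab ?K n \<phi>] \<open>0 < \<gamma>\<close> \<open>\<kappa> < \<gamma>\<close> \<kappa>(1) u K \<phi>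
      \<open>4 * (real n * u * ?K) \<le> real m1 * real m2\<close>
    unfolding D_def X_def S by auto
  have XS: "\<bar>X P $$ w\<bar> \<le> \<gamma>" if "w \<in> positions" for w
    using that \<kappa> \<open>\<kappa> < \<gamma>\<close> by (auto simp: X_def)
  have Xc: "X P \<in> carrier_mat m1 m2" by (simp add: X_def)
  have X: "X P \<in> low_rank_class m1 m2 r \<gamma>"
    using rank[of P \<kappa> "- \<kappa>"] XS Xc mat_max_norm_le_iff[OF Xc m, of \<gamma>]
    by (simp add: low_rank_class_def X_def[symmetric])
  have XS': "\<forall>w\<in>positions. X P $$ w \<in> S"
    using XS by (fastforce simp: S abs_le_iff)
  interpret prob_space "data_law m1 m2 n \<pi> \<nu> h G (X P)"
    by (rule prob_space_data_law[OF XS'])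
  have Td: "T d \<in> carrier_mat m1 m2" if "d \<in> space D" for d
    using T that by (auto simp: estimators_def D_def)
  let ?E = "{d \<in> space D. (mat_frob_norm (T d - X P))\<^sup>2 / (real m1 * real m2) > 1 / 64 * L}"
  have "?E = {d \<in> space D. (\<Sum>w\<in>positions. (T d $$ w - X P $$ w)\<^sup>2) / (real m1 * real m2) > 1 / 64 * L}"
    using frob_norm_diff_sq[OF Td Xc] by auto
  also have "\<dots> \<in> sets D"
    using Tm by measurable
  finally have E: "?E \<in> events"
    using sets_data_law[OF XS'] by (simp add: D_def)
  have "{d \<in> space D. real m1 * real m2 / 16 < real (card {w \<in> positions. (d \<in> \<phi> w) \<noteq> (lab w \<in> P)})} \<subseteq> ?E"
  proof (intro subsetI CollectI conjI; elim CollectE conjE)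
    fix d assume d: "d \<in> space D"
      and many: "real m1 * real m2 / 16 < real (card {w \<in> positions. (d \<in> \<phi> w) \<noteq> (lab w \<in> P)})"
    \<comment> \<open>The constant \<open>1/64\<close> is the factor \<open>1/4\<close> in \<open>\<kappa>\<^sup>2\<close> times the fraction \<open>1/16\<close> of wrong signs.\<close>
    have "L / 4 * (real m1 * real m2 / 16) <
        \<kappa>\<^sup>2 * real (card {w \<in> positions. (d \<in> \<phi> w) \<noteq> (lab w \<in> P)})"
      unfolding \<kappa>(2) using many \<open>0 < L\<close> by (intro mult_strict_left_mono) auto
    also have "\<dots> = \<kappa>\<^sup>2 * real (card {w \<in> positions. (0 < T d $$ w) \<noteq> (lab w \<in> P)})"
      using d by (simp add: \<phi>_def)
    also have "\<dots> \<le> (mat_frob_norm (T d - X P))\<^sup>2"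
      by (rule frob_norm_ge_sign_errors[OF Td[OF d]]) (use \<kappa> in \<open>auto simp: X_def\<close>)
    finally show "(mat_frob_norm (T d - X P))\<^sup>2 / (real m1 * real m2) > 1 / 64 * L"
      using m by (simp add: pos_less_divide_eq)
  qed auto
  from order_trans[OF P finite_measure_mono[OF this E]] X show ?thesis
    unfolding D_def L_def by (rule bexI)
qed

end

theorem theorem14:
  shows "\<exists>c>0. \<exists>\<theta>>0. \<forall>(m1::nat) (m2::nat) (r::nat) (n::nat) (\<gamma>::real) (\<sigma>lo::real) (\<sigma>hi::real)
      (\<pi>::(nat \<times> nat) measure) (\<nu>::real measure) (h::real \<Rightarrow> real) (G::real \<Rightarrow> real).
    2 \<le> m1 \<and> 2 \<le> m2 \<and> 1 \<le> r \<and> r \<le> min m1 m2 \<and> 1 \<le> n \<and> 0 < \<gamma> \<and>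
    prob_space \<pi> \<and> sets \<pi> = sets (count_space ({..<m1} \<times> {..<m2})) \<and>
    natural_exp_family \<nu> h G {-\<gamma>..\<gamma>} \<and>
    0 < \<sigma>lo \<and> 0 < \<sigma>hi \<and> second_deriv_bounds G {-\<gamma>..\<gamma>} \<sigma>lo \<sigma>hi \<longrightarrow>
    (INF T \<in> estimators m1 m2 n. SUP X \<in> low_rank_class m1 m2 r \<gamma>.
       measure (data_law m1 m2 n \<pi> \<nu> h G X)
         {d \<in> space (data_space m1 m2 n).
            (mat_frob_norm (T d - X))\<^sup>2 / (real m1 * real m2) >
              c * min (\<gamma>\<^sup>2) (real (max m1 m2) * real r / (real n * \<sigma>hi\<^sup>2))})
    \<ge> (\<theta>::real)"
proof (rule exI[of _ "1 / 64"], intro conjI, simp, rule exI[of _ "1 / 16"], intro conjI, simp, intro allI impI)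
  fix m1 m2 r n :: nat and \<gamma> \<sigma>lo \<sigma>hi :: real and \<pi> :: "(nat \<times> nat) measure" and \<nu> :: "real measure"
    and h G :: "real \<Rightarrow> real"
  assume *: "2 \<le> m1 \<and> 2 \<le> m2 \<and> 1 \<le> r \<and> r \<le> min m1 m2 \<and> 1 \<le> n \<and> 0 < \<gamma> \<and>
    prob_space \<pi> \<and> sets \<pi> = sets (count_space ({..<m1} \<times> {..<m2})) \<and>
    natural_exp_family \<nu> h G {-\<gamma>..\<gamma>} \<and>
    0 < \<sigma>lo \<and> 0 < \<sigma>hi \<and> second_deriv_bounds G {-\<gamma>..\<gamma>} \<sigma>lo \<sigma>hi"
  then interpret matrix_sampling m1 m2 \<pi> \<nu> h G "{-\<gamma>..\<gamma>}"
    by (simp add: matrix_sampling_def)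
  let ?p = "\<lambda>T X. measure (data_law m1 m2 n \<pi> \<nu> h G X) {d \<in> space (data_space m1 m2 n).
    (mat_frob_norm (T d - X))\<^sup>2 / (real m1 * real m2) >
      1 / 64 * min (\<gamma>\<^sup>2) (real (max m1 m2) * real r / (real n * \<sigma>hi\<^sup>2))}"
  show "1 / 16 \<le> (INF T \<in> estimators m1 m2 n. SUP X \<in> low_rank_class m1 m2 r \<gamma>. ?p T X)"
  proof (rule cINF_greatest)
    have "(\<lambda>_. 0\<^sub>m m1 m2) \<in> estimators m1 m2 n" by (simp add: estimators_def)
    then show "estimators m1 m2 n \<noteq> {}" by blast
  next
    fix T assume "T \<in> estimators m1 m2 n"
    then obtain X where X: "X \<in> low_rank_class m1 m2 r \<gamma>" "1 / 16 \<le> ?p T X"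
      using estimator_error_ge[of \<gamma> r n \<sigma>hi \<sigma>lo T] * by auto
    \<comment> \<open>A supremum of reals is an upper bound only for a bounded set; on the class all laws are probability measures.\<close>
    have "bdd_above (?p T ` low_rank_class m1 m2 r \<gamma>)"
    proof (intro bdd_aboveI2)
      fix Z assume Z: "Z \<in> low_rank_class m1 m2 r \<gamma>"
      then have "\<forall>w\<in>positions. \<bar>Z $$ w\<bar> \<le> \<gamma>"
        using m mat_max_norm_le_iff[of Z m1 m2 \<gamma>] by (simp add: low_rank_class_def)
      then have "\<forall>w\<in>positions. Z $$ w \<in> {-\<gamma>..\<gamma>}"
        by (simp only: abs_le_iff atLeastAtMost_iff minus_le_iff) blast
      then interpret prob_space "data_law m1 m2 n \<pi> \<nu> h G Z" by (rule prob_space_data_law)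
      show "?p T Z \<le> 1" by (rule prob_le_1)
    qed
    from cSUP_upper[OF X(1) this] X(2)
    show "1 / 16 \<le> (SUP X \<in> low_rank_class m1 m2 r \<gamma>. ?p T X)" by linarith
  qed
qed

end
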